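(* Let $\alpha,\beta>-1$, let $P^{(\alpha,\beta)}_{n,k}$ be the Koornwinder polynomials on the parabolic biangle $\Omega=\{(x,y): y^2\le x\le 1\}$, and let $\langle f,g\rangle=\int_{\Omega}f(x,y)g(x,y)(1-x)^{\alpha}(x-y^{2})^{\beta}\,dx\,dy$. Let $n,m\in\mathbb{N}_0$ and $0\leq j\leq m$. If $k\geq 0$ and $n\geq k+1$, then $$\Big\langle P_{m,j}^{(\alpha,\beta)},\frac{\partial}{\partial\alpha}P_{n,k}^{(\alpha,\beta)}\Big\rangle=\begin{cases}0, & k\neq j,\\ 0, & k=j,\ m>n,\\ A_{n,k,m}^{(\alpha,\beta)}, & n>m\geq k=j,\\ B_{n,k}^{(\alpha,\beta)}, & k=j,\ n=m,\end{cases}$$ and if $n=k\geq 0$, then $\Big\langle P_{m,j}^{(\alpha,\beta)},\frac{\partial}{\partial\alpha}P_{n,n}^{(\alpha,\beta)}\Big\rangle=0$, where $$A_{n,k,m}^{(\alpha,\beta)}=\frac{(\alpha+\beta-k+2m+\frac{3}{2})(\beta+m+\frac{3}{2})_{n-m}}{(n-m)(\alpha+\beta+n-k+m+\frac{3}{2})(\alpha+\beta+m+\frac{3}{2})_{n-m}}\,h_{m,k}^{(\alpha,\beta)},\qquad B_{n,k}^{(\alpha,\beta)}=\sum_{s=0}^{n-k-1}\frac{1}{\alpha+\beta+n+s+\frac{3}{2}}\,h_{n,k}^{(\alpha,\beta)},$$ and $$h_{n,k}^{(\alpha,\beta)}=\frac{2^{2\beta+1}\,\Gamma(\beta+k+1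)^{2}\,\Gamma(\alpha+n-k+1)\,\Gamma(\beta+n+\frac{3}{2})}{(n-k)!\,k!\,(2\beta+2k+1)\,\Gamma(2\beta+k+1)\,\Gamma(\alpha+\beta+n+\frac{3}{2})\,(\alpha+\beta+2n-k+\frac{3}{2})}.$$
   Context: The classical Jacobi polynomials are $P_{n}^{(a,b)}(x)=\frac{(-1)^{n}}{2^{n}n!}(1-x)^{-a}(1+x)^{-b}\frac{d^{n}}{dx^{n}}\{(1-x)^{n+a}(1+x)^{n+b}\}$. The Pochhammer symbol is $(a)_0=1$, $(a)_k=a(a+1)\cdots(a+k-1)$ for $k\ge1$. For $\alpha,\beta>-1$ and integers $0\le k\le n$, the Koornwinder polynomials on the parabolic biangle are $$P^{(\alpha,\beta)}_{n,k}(x,y)=P^{(\alpha,\beta+k+\frac{1}{2})}_{n-k}(2x-1)\,x^{k/2}\,P^{(\beta,\beta)}_{k}\!\left(\frac{y}{\sqrt{x}}\right),$$ understood as polynomials in $x,y$. The derivative $\partial/\partial\alpha$ is taken with $\beta,x,y$ fixed (and the weight is not differentiated). At exceptional parameter values ($2\beta+1=0$ with $k=0$, or $\alpha+\beta+\frac32=0$ with lowest indices) where an expression contains a vanishing factor or a pole of $\Gamma$ that cancels, the expression is read as its limit; e.g. $z\Gamma(z)$ means $\Gamma(z+1)$. *)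

theory Defs
  imports "HOL-Analysis.Analysis"
begin

section \<open>Jacobi polynomials\<close>

definition jacobi_rodrigues :: "nat \<Rightarrow> real \<Rightarrow> real \<Rightarrow> real \<Rightarrow> real" where
  "jacobi_rodrigues n a b x =
     (-1) ^ n / (2 ^ n * fact n) * (1 - x) powr (- a) * (1 + x) powr (- b) *
     (deriv ^^ n) (\<lambda>t. (1 - t) powr (real n + a) * (1 + t) powr (real n + b)) x"

text \<open>The real powers in the Rodrigues formula only make sense on the open interval
  from -1 to 1, where the formula determines a polynomial; the lemma \<open>poly_jacobi\<close>
  below shows that this polynomial exists.\<close>

definition jacobi :: "nat \<Rightarrow> real \<Rightarrow> real \<Rightarrow> real poly" where
  "jacobi n a b = (THE p. \<forall>x\<in>{-1<..<1}. poly p x = jacobi_rodrigues n a b x)"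

text \<open>On the open interval, the \<open>i\<close>-th derivative of \<open>(1-x)\<^sup>A (1+x)\<^sup>B\<close> is
  \<open>(1-x)\<close> to the power \<open>A-i\<close> times \<open>(1+x)\<close> to the power \<open>B-i\<close> times the polynomial
  \<open>rodrigues_poly A B i\<close>.\<close>

primrec rodrigues_poly :: "real \<Rightarrow> real \<Rightarrow> nat \<Rightarrow> real poly" where
  "rodrigues_poly A B 0 = 1"
| "rodrigues_poly A B (Suc i) =
     [:B - A, - (A + B) + 2 * real i:] * rodrigues_poly A B i +
     [:1, 0, -1:] * pderiv (rodrigues_poly A B i)"

lemma higher_deriv_powr_powr:
  assumes "x \<in> {-1<..<1}"
  shows "(deriv ^^ i) (\<lambda>t. (1 - t) powr A * (1 + t) powr B) x =
    (1 - x) powr (A - real i) * (1 + x) powr (B - real i) * poly (rodrigues_poly A B i) x"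
  using assms
proof (induction i arbitrary: x)
  case (Suc i)
  let ?q = "rodrigues_poly A B i"
  let ?g = "\<lambda>t. (1 - t) powr (A - real i) * (1 + t) powr (B - real i) * poly ?q t"
  have x: "1 - x > 0" "1 + x > 0" using Suc.prems by auto
  have "((deriv ^^ i) (\<lambda>t. (1 - t) powr A * (1 + t) powr B) has_field_derivative D) (at x)
      \<longleftrightarrow> (?g has_field_derivative D) (at x)" for D
    using Suc.prems eventually_nhds_in_open[of "{-1<..<1::real}" x]
    by (intro DERIV_cong_ev) (auto elim!: eventually_mono simp: Suc.IH)
  then have "deriv ((deriv ^^ i) (\<lambda>t. (1 - t) powr A * (1 + t) powr B)) x = deriv ?g x"
    unfolding deriv_def by simp
  also have "deriv ?g x =
    (1 - x) powr (A - real (Suc i)) * (1 + x) powr (B - real (Suc i)) * poly (rodrigues_poly A B (Suc i)) x"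
  proof (rule DERIV_imp_deriv)
    define u v where "u = (1 - x) powr (A - real (Suc i))" and "v = (1 + x) powr (B - real (Suc i))"
    have uv: "(1 - x) powr (A - real i) = u * (1 - x)" "(1 + x) powr (B - real i) = v * (1 + x)"
      using x powr_add[of "1 - x" "A - real (Suc i)" 1] powr_add[of "1 + x" "B - real (Suc i)" 1]
      by (simp_all add: u_def v_def)
    have uv': "(1 - x) powr (A - real i - 1) = u" "(1 + x) powr (B - real i - 1) = v"
      by (simp_all add: u_def v_def algebra_simps)
    have d1: "((\<lambda>t. (1 - t) powr (A - real i)) has_field_derivative - ((A - real i) * u)) (at x)"
      using x by (auto intro!: derivative_eq_intros simp: uv' uv)
    have d2: "((\<lambda>t. (1 + t) powr (B - real i)) has_field_derivative (B - real i) * v) (at x)"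
      using x by (auto intro!: derivative_eq_intros simp: uv' uv)
    show "(?g has_field_derivative u * v * poly (rodrigues_poly A B (Suc i)) x) (at x)"
      by (rule DERIV_cong[OF DERIV_mult[OF DERIV_mult[OF d1 d2] poly_DERIV]])
        (simp add: uv algebra_simps)
  qed
  finally show ?case by simp
qed simp

lemma jacobi_rodrigues_poly:
  assumes "x \<in> {-1<..<1}"
  shows "jacobi_rodrigues n a b x =
    poly (smult ((-1) ^ n / (2 ^ n * fact n)) (rodrigues_poly (real n + a) (real n + b) n)) x"
  using assms unfolding jacobi_rodrigues_def higher_deriv_powr_powr[OF assms]
  by (simp add: powr_minus field_simps)

lemma jacobi_eq:
  "jacobi n a b = smult ((-1) ^ n / (2 ^ n * fact n)) (rodrigues_poly (real n + a) (real n + b) n)"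
  unfolding jacobi_def
proof (rule the_equality)
  fix p assume p: "\<forall>x\<in>{-1<..<1}. poly p x = jacobi_rodrigues n a b x"
  let ?r = "smult ((-1) ^ n / (2 ^ n * fact n)) (rodrigues_poly (real n + a) (real n + b) n)"
  have "poly (p - ?r) x = 0" if "x \<in> {-1<..<1}" for x
    using that p jacobi_rodrigues_poly[OF that] by simp
  then have "{-1<..<1} \<subseteq> {x. poly (p - ?r) x = 0}" by blast
  then have "infinite {x. poly (p - ?r) x = 0}"
    using infinite_Ioo[of "-1::real" 1] infinite_super[of "{-1<..<1::real}"] by fastforce
  then show "p = ?r" using poly_roots_finite[of "p - ?r"] by auto
qed (intro ballI jacobi_rodrigues_poly[symmetric])

lemma poly_jacobi:
  assumes "x \<in> {-1<..<1}"
  shows "poly (jacobi n a b) x = jacobi_rodrigues n a b x"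
  using assms by (simp add: jacobi_eq jacobi_rodrigues_poly)

section \<open>Koornwinder polynomials on the parabolic biangle\<close>

text \<open>A polynomial in \<open>x\<close> and \<open>y\<close> is a polynomial in \<open>y\<close> whose coefficients
  are polynomials in \<open>x\<close>.\<close>

definition poly2 :: "real poly poly \<Rightarrow> real \<Rightarrow> real \<Rightarrow> real" where
  "poly2 Q x y = poly (poly Q [:y:]) x"

text \<open>Here \<open>sqrt x ^ k\<close> is \<open>x\<close> to the power \<open>k/2\<close>. The defining
  expression is meaningful for \<open>x > 0\<close> only and determines a polynomial there; the lemma
  \<open>poly2_koornwinder\<close> below shows that this polynomial exists.\<close>

definition koornwinder :: "nat \<Rightarrow> nat \<Rightarrow> real \<Rightarrow> real \<Rightarrow> real poly poly" where
  "koornwinder n k \<alpha> \<beta> = (THE Q. \<forall>x y. x > 0 \<longrightarrow>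
     poly2 Q x y =
       poly (jacobi (n - k) \<alpha> (\<beta> + real k + 1/2)) (2 * x - 1) * sqrt x ^ k *
       poly (jacobi k \<beta> \<beta>) (y / sqrt x))"

lemma degree_rodrigues_poly: "degree (rodrigues_poly A B i) \<le> i"
proof (induction i)
  case (Suc i)
  have "degree ([:B - A, - (A + B) + 2 * real i:] * rodrigues_poly A B i) \<le> 1 + i"
    using Suc by (intro order_trans[OF degree_mult_le] add_mono) auto
  moreover have "degree ([:1, 0, -1:] * pderiv (rodrigues_poly A B i)) \<le> Suc i"
  proof (cases "i = 0")
    case False
    have "degree ([:1, 0, -1:] * pderiv (rodrigues_poly A B i)) \<le> 2 + (i - 1)"
      using Suc by (intro order_trans[OF degree_mult_le] add_mono) (auto simp: degree_pderiv)
    then show ?thesis using False by simp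
  qed simp
  ultimately show ?case by (auto intro: degree_add_le)
qed simp

lemma poly_rodrigues_poly_minus:
  "poly (rodrigues_poly A A i) (- x) = (-1) ^ i * poly (rodrigues_poly A A i) x"
proof (induction i arbitrary: x)
  case (Suc i)
  let ?q = "rodrigues_poly A A i"
  have "pcompose ?q [:0, -1:] = smult ((-1) ^ i) ?q"
    by (rule poly_ext) (simp add: poly_pcompose Suc)
  then have "pderiv (pcompose ?q [:0, -1:]) = pderiv (smult ((-1) ^ i) ?q)" by simp
  then have "poly (pderiv (pcompose ?q [:0, -1:])) x = poly (pderiv (smult ((-1) ^ i) ?q)) x"
    by simp
  then have "- poly (pderiv ?q) (- x) = (-1) ^ i * poly (pderiv ?q) x"
    by (simp add: pderiv_pcompose pderiv_smult poly_pcompose pderiv_pCons)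
  then have "poly (pderiv ?q) (- x) = - ((-1) ^ i * poly (pderiv ?q) x)"
    by linarith
  then show ?case by (simp add: Suc algebra_simps)
qed simp

lemma coeff_jacobi_symmetric_eq_0:
  assumes "i > k \<or> odd (k - i)"
  shows "coeff (jacobi k b b) i = 0"
proof (cases "i > k")
  case True
  then show ?thesis using degree_rodrigues_poly[of "real k + b" "real k + b" k]
    by (simp add: jacobi_eq coeff_eq_0)
next
  case False
  let ?q = "jacobi k b b"
  have "pcompose ?q [:0, -1:] = smult ((-1) ^ k) ?q"
    by (rule poly_ext) (simp add: poly_pcompose jacobi_eq poly_rodrigues_poly_minus)
  then have "coeff (pcompose ?q [:0, -1:]) i = (-1) ^ k * coeff ?q i" by simp
  then have "(-1) ^ i * coeff ?q i = (-1) ^ k * coeff ?q i" by (simp add: coeff_pcompose_linear)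
  then show ?thesis using assms False by (cases "even i") auto
qed

lemma poly2_unique:
  assumes "\<And>x y. x > 0 \<Longrightarrow> poly2 P x y = poly2 Q x y"
  shows "P = Q"
proof -
  have "poly P [:y:] = poly Q [:y:]" for y
  proof (rule ccontr)
    assume "poly P [:y:] \<noteq> poly Q [:y:]"
    then have "finite {x. poly (poly P [:y:] - poly Q [:y:]) x = 0}"
      by (intro poly_roots_finite) simp
    moreover have "{0<..} \<subseteq> {x. poly (poly P [:y:] - poly Q [:y:]) x = 0}"
      using assms by (auto simp: poly2_def)
    ultimately show False using infinite_Ioi[of "0::real"] finite_subset by blast
  qed
  then have "range (\<lambda>y. [:y:]) \<subseteq> {z. poly (P - Q) z = 0}" by auto
  moreover have "infinite (range (\<lambda>y::real. [:y:]))"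
    by (subst finite_image_iff) (simp_all add: inj_on_def infinite_UNIV_char_0)
  ultimately have "infinite {z. poly (P - Q) z = 0}" using finite_subset by blast
  then show ?thesis using poly_roots_finite[of "P - Q"] by auto
qed

definition koornwinder_expansion :: "nat \<Rightarrow> nat \<Rightarrow> real \<Rightarrow> real \<Rightarrow> real poly poly" where
  "koornwinder_expansion n k \<alpha> \<beta> =
     smult (pcompose (jacobi (n - k) \<alpha> (\<beta> + real k + 1/2)) [:-1, 2:])
       (\<Sum>i\<le>k. monom (monom (coeff (jacobi k \<beta> \<beta>) i) ((k - i) div 2)) i)"

lemma poly2_koornwinder_expansion:
  assumes "x > 0"
  shows "poly2 (koornwinder_expansion n k \<alpha> \<beta>) x y =
    poly (jacobi (n - k) \<alpha> (\<beta> + real k + 1/2)) (2 * x - 1) * sqrt x ^ k *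
    poly (jacobi k \<beta> \<beta>) (y / sqrt x)"
proof -
  let ?q = "jacobi k \<beta> \<beta>"
  have "degree ?q \<le> k"
    by (intro degree_le) (auto simp: coeff_jacobi_symmetric_eq_0)
  then have "sqrt x ^ k * poly ?q (y / sqrt x) = (\<Sum>i\<le>k. sqrt x ^ k * (coeff ?q i * (y / sqrt x) ^ i))"
    by (simp add: poly_altdef sum_distrib_left[symmetric])
      (intro disjI2 sum.mono_neutral_left; simp add: coeff_eq_0)
  also have "\<dots> = (\<Sum>i\<le>k. coeff ?q i * x ^ ((k - i) div 2) * y ^ i)"
  proof (rule sum.cong)
    fix i assume "i \<in> {..k}"
    show "sqrt x ^ k * (coeff ?q i * (y / sqrt x) ^ i) = coeff ?q i * x ^ ((k - i) div 2) * y ^ i"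
    proof (cases "odd (k - i)")
      case False
      then obtain l where l: "k - i = 2 * l" by (metis evenE)
      then have "sqrt x ^ k = x ^ l * sqrt x ^ i"
        using assms \<open>i \<in> {..k}\<close> power_add[of "sqrt x" "2 * l" i]
          le_add_diff_inverse2[of i k] by (simp add: power_mult)
      then show ?thesis using assms l by (simp add: power_divide)
    qed (simp add: coeff_jacobi_symmetric_eq_0)
  qed simp
  finally show ?thesis
    by (simp add: poly2_def koornwinder_expansion_def poly_pcompose poly_sum poly_monom
        poly_const_pow algebra_simps)
qed

lemma koornwinder_eq: "koornwinder n k \<alpha> \<beta> = koornwinder_expansion n k \<alpha> \<beta>"
  unfolding koornwinder_def
  by (rule the_equality) (auto intro!: poly2_unique simp: poly2_koornwinder_expansion)

lemma poly2_koornwinder: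
  assumes "x > 0"
  shows "poly2 (koornwinder n k \<alpha> \<beta>) x y =
    poly (jacobi (n - k) \<alpha> (\<beta> + real k + 1/2)) (2 * x - 1) * sqrt x ^ k *
    poly (jacobi k \<beta> \<beta>) (y / sqrt x)"
  using assms by (simp add: koornwinder_eq poly2_koornwinder_expansion)

definition biangle :: "(real \<times> real) set" where
  "biangle = {(x, y). y\<^sup>2 \<le> x \<and> x \<le> 1}"

definition biangle_inner ::
    "real \<Rightarrow> real \<Rightarrow> (real \<Rightarrow> real \<Rightarrow> real) \<Rightarrow> (real \<Rightarrow> real \<Rightarrow> real) \<Rightarrow> real" where
  "biangle_inner \<alpha> \<beta> f g = set_lebesgue_integral lborel biangle
     (\<lambda>(x, y). f x y * g x y * (1 - x) powr \<alpha> * (x - y\<^sup>2) powr \<beta>)"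

section \<open>The constants\<close>

text \<open>The generic formula for the norm has the denominator factors
  \<open>(2\<beta>+2k+1) \<Gamma>(2\<beta>+k+1)\<close> and \<open>\<Gamma>(\<alpha>+\<beta>+n+3/2) (\<alpha>+\<beta>+2n-k+3/2)\<close>. The first one is of
  the form \<open>z \<Gamma>(z)\<close> for \<open>k = 0\<close> and the second one for \<open>n = k = 0\<close>; in these cases it is
  written as \<open>\<Gamma>(z+1)\<close>, which also covers \<open>z = 0\<close>. The lemmas \<open>koornwinder_h_generic\<close> and
  \<open>isCont_koornwinder_h\<close> relate this to the generic formula and its limit.\<close>

definition koornwinder_h :: "nat \<Rightarrow> nat \<Rightarrow> real \<Rightarrow> real \<Rightarrow> real" where
  "koornwinder_h n k \<alpha> \<beta> =
     2 powr (2 * \<beta> + 1) * (Gamma (\<beta> + real k + 1))\<^sup>2 *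
     Gamma (\<alpha> + real n - real k + 1) * Gamma (\<beta> + real n + 3/2) /
     (fact (n - k) * fact k *
      (if k = 0 then Gamma (2 * \<beta> + 2)
       else (2 * \<beta> + 2 * real k + 1) * Gamma (2 * \<beta> + real k + 1)) *
      (if n = 0 then Gamma (\<alpha> + \<beta> + 5/2)
       else Gamma (\<alpha> + \<beta> + real n + 3/2) * (\<alpha> + \<beta> + 2 * real n - real k + 3/2)))"

text \<open>Similarly, for \<open>m = k = 0\<close> the factor \<open>\<alpha>+\<beta>-k+2m+3/2\<close> cancels against the first factor
  of the Pochhammer symbol in the denominator; see \<open>koornwinder_A_generic\<close> and
  \<open>isCont_koornwinder_A\<close>.\<close>

definition koornwinder_A :: "nat \<Rightarrow> nat \<Rightarrow> nat \<Rightarrow> real \<Rightarrow> real \<Rightarrow> real" where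
  "koornwinder_A n k m \<alpha> \<beta> =
     (if m = 0 then 1 / pochhammer (\<alpha> + \<beta> + 5/2) (n - 1)
      else (\<alpha> + \<beta> - real k + 2 * real m + 3/2) / pochhammer (\<alpha> + \<beta> + real m + 3/2) (n - m)) *
     pochhammer (\<beta> + real m + 3/2) (n - m) /
     (real (n - m) * (\<alpha> + \<beta> + real n - real k + real m + 3/2)) *
     koornwinder_h m k \<alpha> \<beta>"

definition koornwinder_B :: "nat \<Rightarrow> nat \<Rightarrow> real \<Rightarrow> real \<Rightarrow> real" where
  "koornwinder_B n k \<alpha> \<beta> =
     (\<Sum>s<n - k. 1 / (\<alpha> + \<beta> + real n + real s + 3/2)) * koornwinder_h n k \<alpha> \<beta>"

lemma koornwinder_h_generic:
  assumes "k \<le> n" "k = 0 \<longrightarrow> 2 * \<beta> + 1 \<noteq> 0" "n = 0 \<longrightarrow> \<alpha> + \<beta> + 3/2 \<noteq> 0"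
    and "\<alpha> > -1" "\<beta> > -1"
  shows "koornwinder_h n k \<alpha> \<beta> =
     2 powr (2 * \<beta> + 1) * (Gamma (\<beta> + real k + 1))\<^sup>2 *
     Gamma (\<alpha> + real n - real k + 1) * Gamma (\<beta> + real n + 3/2) /
     (fact (n - k) * fact k * (2 * \<beta> + 2 * real k + 1) * Gamma (2 * \<beta> + real k + 1) *
      Gamma (\<alpha> + \<beta> + real n + 3/2) * (\<alpha> + \<beta> + 2 * real n - real k + 3/2))"
proof -
  have G: "Gamma (z + 1) = z * Gamma z" if "z \<noteq> 0" "z > -1" for z :: real
    using that by (intro Gamma_plus1) (auto elim!: nonpos_Ints_cases)
  have 1: "(if k = 0 then Gamma (2 * \<beta> + 2)
       else (2 * \<beta> + 2 * real k + 1) * Gamma (2 * \<beta> + real k + 1)) =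
      (2 * \<beta> + 2 * real k + 1) * Gamma (2 * \<beta> + real k + 1)"
    using G[of "2 * \<beta> + 1"] assms by (auto simp: add.assoc)
  have 2: "(if n = 0 then Gamma (\<alpha> + \<beta> + 5/2)
       else Gamma (\<alpha> + \<beta> + real n + 3/2) * (\<alpha> + \<beta> + 2 * real n - real k + 3/2)) =
      Gamma (\<alpha> + \<beta> + real n + 3/2) * (\<alpha> + \<beta> + 2 * real n - real k + 3/2)"
    using G[of "\<alpha> + \<beta> + 3/2"] assms by (auto simp: add.assoc)
  show ?thesis unfolding koornwinder_h_def 1 2 by (simp only: mult.assoc)
qed

lemma isCont_koornwinder_h:
  assumes "k \<le> n" "\<alpha> > -1" "\<beta> > -1"
  shows "isCont (\<lambda>(a, b). koornwinder_h n k a b) (\<alpha>, \<beta>)"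
proof -
  have N: "z \<notin> \<int>\<^sub>\<le>\<^sub>0" if "z > 0" for z :: real
    using that by (auto elim!: nonpos_Ints_cases)
  have k: "real k \<le> real n" "k \<noteq> 0 \<Longrightarrow> real k \<ge> 1" "n \<noteq> 0 \<Longrightarrow> real n \<ge> 1"
    using assms by auto
  have P: "\<beta> + real k + 1 > 0" "\<alpha> + real n - real k + 1 > 0" "\<beta> + real n + 3/2 > 0"
    "2 * \<beta> + 2 > 0" "\<alpha> + \<beta> + 5/2 > 0"
    using assms k by linarith+
  have P': "2 * \<beta> + 2 * real k + 1 > 0" "2 * \<beta> + real k + 1 > 0" if "k \<noteq> 0"
    using assms k(2)[OF that] by linarith+
  have P'': "\<alpha> + \<beta> + real n + 3/2 > 0" "\<alpha> + \<beta> + 2 * real n - real k + 3/2 > 0" if "n \<noteq> 0"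
    using assms k(1) k(3)[OF that] by linarith+
  have G: "isCont (\<lambda>p. Gamma (f p)) (\<alpha>, \<beta>)" and G0: "Gamma (f (\<alpha>, \<beta>)) \<noteq> 0"
    if "isCont f (\<alpha>, \<beta>)" "f (\<alpha>, \<beta>) > 0" for f :: "real \<times> real \<Rightarrow> real"
    using that N[OF that(2)] Gamma_real_pos[OF that(2)]
    unfolding isCont_def by (simp_all add: tendsto_Gamma less_imp_neq[THEN not_sym])
  have 1: "isCont (\<lambda>p. if k = 0 then Gamma (2 * snd p + 2)
      else (2 * snd p + 2 * real k + 1) * Gamma (2 * snd p + real k + 1)) (\<alpha>, \<beta>)"
    using P P' by (cases "k = 0") (auto intro!: continuous_intros G simp del: mult_eq_0_iff)
  have 2: "isCont (\<lambda>p. if n = 0 then Gamma (fst p + snd p + 5/2)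
      else Gamma (fst p + snd p + real n + 3/2) * (fst p + snd p + 2 * real n - real k + 3/2)) (\<alpha>, \<beta>)"
    using P P'' by (cases "n = 0") (auto intro!: continuous_intros G)
  have 3: "(if k = 0 then Gamma (2 * \<beta> + 2)
      else (2 * \<beta> + 2 * real k + 1) * Gamma (2 * \<beta> + real k + 1)) \<noteq> 0"
    using P P' Gamma_real_pos[of "2 * \<beta> + 2"] Gamma_real_pos[of "2 * \<beta> + real k + 1"]
    by (cases "k = 0") (simp_all add: less_imp_neq[THEN not_sym])
  have 4: "(if n = 0 then Gamma (\<alpha> + \<beta> + 5/2)
      else Gamma (\<alpha> + \<beta> + real n + 3/2) * (\<alpha> + \<beta> + 2 * real n - real k + 3/2)) \<noteq> 0"
    using P P'' Gamma_real_pos[of "\<alpha> + \<beta> + 5/2"] Gamma_real_pos[of "\<alpha> + \<beta> + real n + 3/2"]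
    by (cases "n = 0") (simp_all add: less_imp_neq[THEN not_sym])
  have 5: "isCont (\<lambda>p. 2 powr (2 * snd p + 1) * (Gamma (snd p + real k + 1))\<^sup>2 *
      Gamma (fst p + real n - real k + 1) * Gamma (snd p + real n + 3/2)) (\<alpha>, \<beta>)"
    using P by (auto intro!: continuous_intros G)
  have 6: "isCont (\<lambda>p. fact (n - k) * fact k * (if k = 0 then Gamma (2 * snd p + 2)
      else (2 * snd p + 2 * real k + 1) * Gamma (2 * snd p + real k + 1)) *
      (if n = 0 then Gamma (fst p + snd p + 5/2)
      else Gamma (fst p + snd p + real n + 3/2) * (fst p + snd p + 2 * real n - real k + 3/2))) (\<alpha>, \<beta>)"
    by (intro isCont_mult 1 2 continuous_const)
  show ?thesis
    unfolding koornwinder_h_def case_prod_unfold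
    by (intro isCont_divide 5 6) (use 3 4 in \<open>simp split: if_splits\<close>)
qed

lemma koornwinder_A_generic:
  assumes "k \<le> m" "m < n" "m = 0 \<longrightarrow> \<alpha> + \<beta> + 3/2 \<noteq> 0"
  shows "koornwinder_A n k m \<alpha> \<beta> =
     (\<alpha> + \<beta> - real k + 2 * real m + 3/2) * pochhammer (\<beta> + real m + 3/2) (n - m) /
     (real (n - m) * (\<alpha> + \<beta> + real n - real k + real m + 3/2) *
      pochhammer (\<alpha> + \<beta> + real m + 3/2) (n - m)) * koornwinder_h m k \<alpha> \<beta>"
proof (cases "m = 0")
  case True
  then have "pochhammer (\<alpha> + \<beta> + 3/2) n = (\<alpha> + \<beta> + 3/2) * pochhammer (\<alpha> + \<beta> + 5/2) (n - 1)"
    using assms(2) by (cases n) (simp_all add: pochhammer_rec add.assoc)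
  then show ?thesis using True assms by (simp add: koornwinder_A_def)
next
  case False
  then show ?thesis by (simp add: koornwinder_A_def mult_ac)
qed

lemma isCont_koornwinder_A:
  assumes "k \<le> m" "m < n" "\<alpha> > -1" "\<beta> > -1"
  shows "isCont (\<lambda>(a, b). koornwinder_A n k m a b) (\<alpha>, \<beta>)"
proof -
  have nz: "pochhammer z l \<noteq> 0" if "z > 0" for z :: real and l
    using pochhammer_pos[OF that, of l] by simp
  have P: "pochhammer (\<alpha> + \<beta> + 5/2) (n - 1) \<noteq> 0"
    using assms by (intro nz) simp
  have Q: "pochhammer (\<alpha> + \<beta> + real m + 3/2) (n - m) \<noteq> 0" if "m \<noteq> 0"
    using assms that by (intro nz) simp
  have R: "real (n - m) * (\<alpha> + \<beta> + real n - real k + real m + 3/2) \<noteq> 0"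
    using assms by auto
  have 1: "isCont (\<lambda>p. if m = 0 then 1 / pochhammer (fst p + snd p + 5/2) (n - 1)
      else (fst p + snd p - real k + 2 * real m + 3/2) /
        pochhammer (fst p + snd p + real m + 3/2) (n - m)) (\<alpha>, \<beta>)"
    using P Q unfolding pochhammer_prod
    by (cases "m = 0") (auto intro!: continuous_intros simp del: prod_zero_iff)
  have 2: "isCont (\<lambda>p. pochhammer (snd p + real m + 3/2) (n - m)) (\<alpha>, \<beta>)"
    unfolding pochhammer_prod by (intro continuous_intros)
  have 3: "isCont (\<lambda>p. koornwinder_h m k (fst p) (snd p)) (\<alpha>, \<beta>)"
    using isCont_koornwinder_h[OF assms(1,3,4)] by (simp add: case_prod_unfold)
  show ?thesis
    unfolding koornwinder_A_def case_prod_unfold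
    by (intro isCont_mult isCont_divide 1 2 3 continuous_intros) (use R in simp)
qed

end

theory Submission
  imports Defs
begin

text \<open>
  The substitution \<open>y = sqrt x * (2 s - 1)\<close> carries the unit square onto the biangle and turns the weight
  \<open>(1 - x)\<^sup>\<alpha> (x - y\<^sup>2)\<^sup>\<beta>\<close> into a product of two Beta weights, one in \<open>x\<close> and one in \<open>s\<close>; the Koornwinder
  polynomials become products as well (\<open>biangle_inner_separated\<close>). The factor in \<open>s\<close> is
  independent of \<open>\<alpha>\<close>, so orthogonality of the Gegenbauer-type factors removes all terms with
  \<open>k \<noteq> j\<close>. For \<open>k = j\<close> the \<open>x\<close>-integral pairs a Jacobi polynomial with the derivative of a Jacobi
  polynomial in its first parameter, both with second parameter \<open>b = \<beta> + k + 1/2\<close>.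

  Let \<open>S\<^sub>n\<^sup>a\<close> be the Jacobi polynomial of degree \<open>n\<close> with parameters \<open>a, b\<close>, moved to the unit interval.
  Its derivative in \<open>a\<close> is obtained without expanding it in a basis: the integral of
  \<open>S\<^sub>m\<^sup>a S\<^sub>n\<^sup>c\<close> against \<open>(1 - x)\<^sup>a x\<^sup>b\<close> has a closed form in \<open>c\<close>, and the wanted number is the derivative of this
  closed form at \<open>c = a\<close>. The closed form has three ingredients, and the first and the last both
  come from integrating by parts along the Rodrigues formula:

  \<^item> \<open>m\<close> integrations by parts move all derivatives off \<open>S\<^sub>m\<^sup>a\<close>
    (\<open>beta_integral_mult_shifted_jacobi\<close>);

  \<^item> the \<open>m\<close>-th derivative of \<open>S\<^sub>n\<^sup>c\<close> is \<open>(n + c + b + 1)\<^sub>m\<close> times the Jacobi polynomial of degree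
    \<open>n - m\<close> with parameters \<open>c + m\<close> and \<open>b + m\<close> (\<open>higher_pderiv_shifted_jacobi\<close>);

  \<^item> the integral of this polynomial against the weight with exponents \<open>a + m\<close> and \<open>b + m\<close> is
    \<open>(c - a)\<^sub>n\<^sub>-\<^sub>m / (n - m)!\<close> times a Beta value (\<open>beta_integral_shifted_jacobi\<close>).

  For \<open>m < n\<close> the factor \<open>(c - a)\<^sub>n\<^sub>-\<^sub>m\<close> has a simple zero at \<open>c = a\<close>, and its slope \<open>(n - m - 1)!\<close> yields
  the coefficient \<open>A\<close>. For \<open>m = n\<close> only \<open>(n + c + b + 1)\<^sub>n\<close> depends on \<open>c\<close>, and its logarithmic
  derivative is the sum in \<open>B\<close>.
\<close>

section \<open>Integrals of polynomials against the Beta weight\<close>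

text \<open>The convention \<open>0 powr z = 0\<close> affects the end points of the interval only. It makes
  multiplication by \<open>x\<close> or \<open>1 - x\<close> equal to a shift of an exponent at every point of the interval.\<close>

definition beta_integral :: "real \<Rightarrow> real \<Rightarrow> real poly \<Rightarrow> real" where
  "beta_integral a b p = (LINT x:{0..1}|lborel. poly p x * (1 - x) powr a * x powr b)"

lemma beta_integrable_monomial:
  assumes "a > -1" "b > -1"
  shows "set_integrable lborel {0..1::real} (\<lambda>x. x ^ k * (1 - x) powr a * x powr b)"
proof -
  have "set_integrable lborel {0..1::real} (\<lambda>x. x powr (real k + b + 1 - 1) * (1 - x) powr (a + 1 - 1))"
    using assms by (intro integrable_Beta) auto
  also have "?this \<longleftrightarrow> ?thesis"
    by (intro set_integrable_cong refl) (auto simp: powr_add powr_realpow less_eq_real_def)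
  finally show ?thesis .
qed

lemma beta_integrable:
  assumes "a > -1" "b > -1"
  shows "set_integrable lborel {0..1::real} (\<lambda>x. poly p x * (1 - x) powr a * x powr b)"
proof -
  have "set_integrable lborel {0..1::real}
      (\<lambda>x. \<Sum>k\<le>degree p. coeff p k * (x ^ k * (1 - x) powr a * x powr b))"
    using beta_integrable_monomial[OF assms]
    unfolding set_integrable_def scaleR_sum_right
    by (intro Bochner_Integration.integrable_sum)
      (simp add: mult.left_commute[of "indicator A x" for A x])
  then show ?thesis by (simp add: poly_altdef sum_distrib_left sum_distrib_right mult_ac)
qed

lemma beta_integral_add:
  assumes "a > -1" "b > -1"
  shows "beta_integral a b (p + q) = beta_integral a b p + beta_integral a b q"
  unfolding beta_integral_def
  using set_integral_add(2)[OF beta_integrable[OF assms, of p] beta_integrable[OF assms, of q]]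
  by (simp add: distrib_right)

lemma beta_integral_smult: "beta_integral a b (smult c p) = c * beta_integral a b p"
  unfolding beta_integral_def by (simp add: mult.assoc)

lemma beta_integral_0: "beta_integral a b 0 = 0"
  by (simp add: beta_integral_def)

lemma beta_integral_diff:
  assumes "a > -1" "b > -1"
  shows "beta_integral a b (p - q) = beta_integral a b p - beta_integral a b q"
  using beta_integral_add[OF assms, of "p - q" q] by simp

lemma beta_integral_times_x: "beta_integral a b ([:0, 1:] * p) = beta_integral a (b + 1) p"
  unfolding beta_integral_def
  by (intro set_lebesgue_integral_cong) (auto simp: powr_add less_eq_real_def)

lemma beta_integral_times_1_minus_x:
  "beta_integral a b ([:1, -1:] * p) = beta_integral (a + 1) b p"
  unfolding beta_integral_def
  by (intro set_lebesgue_integral_cong) (auto simp: powr_add less_eq_real_def algebra_simps)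

lemma beta_integral_1:
  assumes "a > -1" "b > -1"
  shows "beta_integral a b 1 = Beta (b + 1) (a + 1)"
proof -
  have "set_integrable lborel {0..1::real} (\<lambda>t. t powr (b + 1 - 1) * (1 - t) powr (a + 1 - 1))"
    using assms by (intro integrable_Beta) auto
  then have "(LINT t:{0..1}|lborel. t powr (b + 1 - 1) * (1 - t) powr (a + 1 - 1)) =
      integral {0..1} (\<lambda>t. t powr (b + 1 - 1) * (1 - t) powr (a + 1 - 1))"
    by (rule set_borel_integral_eq_integral)
  also have "\<dots> = Beta (b + 1) (a + 1)"
    using assms by (intro integral_unique has_integral_Beta_real) auto
  finally show ?thesis by (simp add: beta_integral_def mult.commute)
qed

lemma Beta_plus1_right_left:
  assumes "x > 0" "y > (0::real)"
  shows "x * Beta x (y + 1) = y * Beta (x + 1) y"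
proof -
  have "(x + y) * (x * Beta x (y + 1)) = (x + y) * (y * Beta (x + 1) y)"
    using Beta_plus1_left[of x y] Beta_plus1_right[of y x] assms
    by (metis mult.left_commute linorder_not_less nonpos_Ints_nonpos)
  then show ?thesis using assms by simp
qed

text \<open>The integrand is the derivative of \<open>p (1 - x)\<^sup>a\<^sup>+\<^sup>1 x\<^sup>b\<^sup>+\<^sup>1\<close>, which vanishes at both end points. By
  linearity and the shift of \<open>b\<close> under multiplication by \<open>x\<close> it suffices to treat \<open>p = 1\<close>, where the
  claim is the functional equation of the Beta function.\<close>

lemma beta_integral_by_parts:
  assumes "a > -1" "b > -1"
  shows "beta_integral a b ([:0, 1, -1:] * pderiv p + [:b + 1, - (a + b + 2):] * p) = 0"
  using assms
proof (induction p arbitrary: b)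
  case (pCons c p)
  have "[:b + 1, - (a + b + 2):] = smult (b + 1) ([:1, -1:] * 1) - smult (a + 1) ([:0, 1:] * 1)"
    by simp
  then have "beta_integral a b [:b + 1, - (a + b + 2):] =
      (b + 1) * beta_integral (a + 1) b 1 - (a + 1) * beta_integral a (b + 1) 1"
    using pCons.prems
    by (simp only: beta_integral_diff beta_integral_smult beta_integral_times_x
        beta_integral_times_1_minus_x)
  then have 0: "beta_integral a b [:b + 1, - (a + b + 2):] = 0"
    using pCons.prems Beta_plus1_right_left[of "b + 1" "a + 1"] by (simp add: beta_integral_1)
  have "[:0, 1, -1:] * pderiv (pCons c p) + [:b + 1, - (a + b + 2):] * pCons c p =
      smult c [:b + 1, - (a + b + 2):] +
      [:0, 1:] * ([:0, 1, -1:] * pderiv p + [:b + 1 + 1, - (a + (b + 1) + 2):] * p)"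
    by (rule poly_ext) (simp add: pderiv_pCons algebra_simps)
  then show ?case
    using pCons.prems pCons.IH[of "b + 1"]
    by (simp only: beta_integral_add beta_integral_smult beta_integral_times_x 0)
qed (simp add: beta_integral_0)

lemma beta_integral_by_parts_add:
  assumes "a > -1" "b > -1"
  shows "beta_integral a b (([:0, 1, -1:] * pderiv p + [:b + 1, - (a + b + 2):] * p) + q) =
    beta_integral a b q"
  using beta_integral_by_parts[OF assms, of p] beta_integral_add[OF assms] by simp

section \<open>Jacobi polynomials on the unit interval\<close>

text \<open>Up to a power of 2, the polynomial that remains when \<open>(1 - x)\<^sup>A\<^sup>-\<^sup>n x\<^sup>B\<^sup>-\<^sup>n\<close> is split off the \<open>n\<close>-th
  derivative of \<open>(1 - x)\<^sup>A x\<^sup>B\<close>.\<close>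

definition shifted_rodrigues :: "real \<Rightarrow> real \<Rightarrow> nat \<Rightarrow> real poly" where
  "shifted_rodrigues A B n = pcompose (rodrigues_poly A B n) [:-1, 2:]"

definition shifted_jacobi :: "nat \<Rightarrow> real \<Rightarrow> real \<Rightarrow> real poly" where
  "shifted_jacobi n a b = pcompose (jacobi n a b) [:-1, 2:]"

lemma shifted_jacobi_eq:
  "shifted_jacobi n a b =
    smult ((-1) ^ n / (2 ^ n * fact n)) (shifted_rodrigues (real n + a) (real n + b) n)"
  by (simp add: shifted_jacobi_def shifted_rodrigues_def jacobi_eq pcompose_smult)

lemma shifted_rodrigues_0: "shifted_rodrigues A B 0 = 1"
  by (simp add: shifted_rodrigues_def pcompose_1)

lemma shifted_rodrigues_Suc:
  "shifted_rodrigues A B (Suc i) =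
    smult 2 ([:0, 1, -1:] * pderiv (shifted_rodrigues A B i) +
      [:B - real i, - (A + B - 2 * real i):] * shifted_rodrigues A B i)"
  by (rule poly_ext)
    (simp add: shifted_rodrigues_def poly_pcompose pderiv_pcompose pderiv_pCons algebra_simps)

text \<open>One integration by parts for each derivative in the Rodrigues formula: passing from
  \<open>i + 1\<close> to \<open>i\<close> differentiates \<open>q\<close> once and raises both exponents of the weight by one.\<close>

lemma beta_integral_mult_shifted_rodrigues:
  assumes "A - real i > -1" "B - real i > -1"
  shows "beta_integral (A - real i) (B - real i) (q * shifted_rodrigues A B i) =
    (-2) ^ i * beta_integral A B ((pderiv ^^ i) q)"
  using assms
proof (induction i arbitrary: q)
  case (Suc i)
  let ?T = "shifted_rodrigues A B i" and ?a = "A - real (Suc i)" and ?b = "B - real (Suc i)"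
  have "q * shifted_rodrigues A B (Suc i) =
      smult 2 (([:0, 1, -1:] * pderiv (q * ?T) + [:?b + 1, - (?a + ?b + 2):] * (q * ?T)) +
        smult (-1) ([:0, 1:] * ([:1, -1:] * (pderiv q * ?T))))"
    by (rule poly_ext) (simp add: shifted_rodrigues_Suc pderiv_mult algebra_simps)
  then have "beta_integral ?a ?b (q * shifted_rodrigues A B (Suc i)) =
      2 * (-1 * beta_integral (?a + 1) (?b + 1) (pderiv q * ?T))"
    using Suc.prems
    by (simp only: beta_integral_smult beta_integral_times_x
        beta_integral_times_1_minus_x beta_integral_by_parts_add)
  also have "?a + 1 = A - real i" by simp
  also have "?b + 1 = B - real i" by simp
  finally show ?case using Suc.IH[of "pderiv q"] Suc.prems by (simp add: funpow_Suc_right del: funpow.simps)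
qed (simp add: shifted_rodrigues_0)

text \<open>This yields orthogonality (the right-hand side vanishes if \<open>degree q < n\<close>) as well as the norm.\<close>

lemma beta_integral_mult_shifted_jacobi:
  assumes "a > -1" "b > -1"
  shows "beta_integral a b (q * shifted_jacobi n a b) =
    beta_integral (real n + a) (real n + b) ((pderiv ^^ n) q) / fact n"
proof -
  have "(-1) ^ n * (-2) ^ n = (2 ^ n :: real)" by (simp flip: power_mult_distrib)
  then show ?thesis
    using beta_integral_mult_shifted_rodrigues[of "real n + a" n "real n + b" q] assms
    by (simp add: shifted_jacobi_eq beta_integral_smult) (simp flip: mult.assoc)
qed

text \<open>If the exponent \<open>c\<close> of the weight does not match the parameter \<open>A\<close>, then each integration by
  parts leaves a remainder proportional to the mismatch, and these factors accumulate to a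
  Pochhammer symbol.\<close>

lemma beta_integral_shifted_rodrigues:
  assumes "c > -1" "B - real i > -1"
  shows "beta_integral c (B - real i) (shifted_rodrigues A B i) =
    2 ^ i * pochhammer (c + 1 - A) i * Beta (B + 1) (c + 1)"
  using assms
proof (induction i)
  case (Suc i)
  let ?T = "shifted_rodrigues A B i" and ?b = "B - real (Suc i)"
  have "shifted_rodrigues A B (Suc i) =
      smult 2 (([:0, 1, -1:] * pderiv ?T + [:?b + 1, - (c + ?b + 2):] * ?T) +
        smult (c + 1 - A + real i) ([:0, 1:] * ?T))"
    by (rule poly_ext) (simp add: shifted_rodrigues_Suc algebra_simps)
  then have "beta_integral c ?b (shifted_rodrigues A B (Suc i)) =
      2 * ((c + 1 - A + real i) * beta_integral c (?b + 1) ?T)"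
    using Suc.prems
    by (simp only: beta_integral_smult beta_integral_times_x beta_integral_by_parts_add)
  also have "?b + 1 = B - real i" by simp
  finally show ?case using Suc by (simp add: pochhammer_Suc)
qed (simp add: shifted_rodrigues_0 beta_integral_1)

lemma beta_integral_shifted_jacobi:
  assumes "a > -1" "b > -1"
  shows "beta_integral a b (shifted_jacobi n a' b) =
    pochhammer (a' - a) n / fact n * Beta (b + real n + 1) (a + 1)"
proof -
  have "pochhammer (a' - a) n = (-1) ^ n * pochhammer (a + 1 - (real n + a')) n"
    using pochhammer_minus[of "a - a'" n] by (simp add: algebra_simps)
  then show ?thesis
    using beta_integral_shifted_rodrigues[of a "real n + b" n "real n + a'"] assms
    by (simp add: shifted_jacobi_eq beta_integral_smult algebra_simps)
qed

text \<open>For fixed \<open>A\<close> and \<open>B\<close>, differentiation lowers the index. In terms of Jacobi polynomials this is the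
  rule that the derivative has degree \<open>n - 1\<close> and parameters \<open>a + 1\<close> and \<open>b + 1\<close>, because
  \<open>A = n + a\<close> and \<open>B = n + b\<close> stay the same.\<close>

lemma pderiv_rodrigues_poly:
  "pderiv (rodrigues_poly A B (Suc n)) =
    smult (- (real (Suc n) * (A + B - real n))) (rodrigues_poly A B n)"
proof (induction n)
  case (Suc n)
  let ?R = "rodrigues_poly A B" and ?c = "real (Suc n) * (A + B - real n)"
  have "pderiv (?R (Suc (Suc n))) =
      [:- (A + B) + 2 * real (Suc n):] * ?R (Suc n) +
      [:B - A, - (A + B) + 2 * real n:] * pderiv (?R (Suc n)) +
      [:1, 0, -1:] * pderiv (pderiv (?R (Suc n)))"
    by (subst rodrigues_poly.simps(2), rule poly_ext)
      (simp only: pderiv_mult pderiv_add poly_add poly_mult, simp add: pderiv_pCons algebra_simps del: rodrigues_poly.simps)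
  also have "\<dots> = [:- (A + B) + 2 * real (Suc n):] * ?R (Suc n) - smult ?c (?R (Suc n))"
    unfolding Suc by (rule poly_ext) (simp add: pderiv_smult algebra_simps)
  also have "\<dots> = smult (- (real (Suc (Suc n)) * (A + B - real (Suc n)))) (?R (Suc n))"
    by (rule poly_ext) (simp add: algebra_simps del: rodrigues_poly.simps)
  finally show ?case .
qed (simp add: pderiv_pCons)

lemma pderiv_shifted_rodrigues:
  "pderiv (shifted_rodrigues A B (Suc n)) =
    smult (-2 * (real (Suc n) * (A + B - real n))) (shifted_rodrigues A B n)"
  unfolding shifted_rodrigues_def pderiv_pcompose pderiv_rodrigues_poly
  by (rule poly_ext) (simp add: poly_pcompose pderiv_pCons pcompose_smult)

lemma pderiv_shifted_jacobi:
  "pderiv (shifted_jacobi (Suc n) a b) =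
    smult (real (Suc n) + a + b + 1) (shifted_jacobi n (a + 1) (b + 1))"
proof -
  have "(-1) ^ Suc n / (2 ^ Suc n * fact (Suc n)) *
       (-2 * (real (Suc n) * (real (Suc n) + a + (real (Suc n) + b) - real n))) =
      (real (Suc n) + a + b + 1) * ((-1) ^ n / (2 ^ n * fact n))"
    by (simp add: field_simps del: of_nat_Suc) (simp add: algebra_simps)
  moreover have "real (Suc n) + a = real n + (a + 1)" "real (Suc n) + b = real n + (b + 1)"
    by simp_all
  ultimately show ?thesis
    by (simp only: shifted_jacobi_eq pderiv_smult pderiv_shifted_rodrigues smult_smult)
qed

lemma shifted_jacobi_0: "shifted_jacobi 0 a b = 1"
  by (simp add: shifted_jacobi_eq shifted_rodrigues_0)

lemma higher_pderiv_shifted_jacobi: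
  assumes "m \<le> n"
  shows "(pderiv ^^ m) (shifted_jacobi n a b) =
    smult (pochhammer (real n + a + b + 1) m)
      (shifted_jacobi (n - m) (real m + a) (real m + b))"
  using assms
proof (induction m)
  case (Suc m)
  then obtain l where l: "n = Suc (m + l)" using less_iff_Suc_add[of m n] by auto
  then show ?case
    using Suc pderiv_shifted_jacobi[of l "real m + a" "real m + b"]
    by (simp add: pderiv_smult pochhammer_Suc algebra_simps)
qed simp

lemma higher_pderiv_shifted_jacobi_eq_0:
  assumes "m > n"
  shows "(pderiv ^^ m) (shifted_jacobi n a b) = 0"
proof -
  obtain l where l: "m = Suc (l + n)" using assms less_iff_Suc_add[of n m] by (auto simp: add_ac)
  have "(pderiv ^^ Suc n) (shifted_jacobi n a b) = 0"
    by (simp add: higher_pderiv_shifted_jacobi shifted_jacobi_0 pderiv_smult)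
  then have "(pderiv ^^ l) ((pderiv ^^ Suc n) (shifted_jacobi n a b)) = 0" by simp
  then show ?thesis unfolding l by (metis add_Suc_right comp_apply funpow_add)
qed

lemma beta_integral_shifted_jacobi_mult_gt:
  assumes "a > -1" "b > -1" "m > n"
  shows "beta_integral a b (shifted_jacobi m a b * shifted_jacobi n a' b) = 0"
  using assms
  by (subst mult.commute)
    (simp add: beta_integral_mult_shifted_jacobi higher_pderiv_shifted_jacobi_eq_0 beta_integral_0)

text \<open>The closed form that is differentiated in \<open>a'\<close> later on. At \<open>a' = a\<close> it vanishes for \<open>m < n\<close> and
  gives the norm for \<open>m = n\<close>.\<close>

lemma beta_integral_shifted_jacobi_mult_le:
  assumes "a > -1" "b > -1" "m \<le> n"
  shows "beta_integral a b (shifted_jacobi m a b * shifted_jacobi n a' b) =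
    pochhammer (real n + a' + b + 1) m * pochhammer (a' - a) (n - m) *
    Beta (real n + b + 1) (real m + a + 1) / (fact m * fact (n - m))"
proof -
  have "beta_integral a b (shifted_jacobi n a' b * shifted_jacobi m a b) =
    pochhammer (real n + a' + b + 1) m * beta_integral (real m + a) (real m + b)
      (shifted_jacobi (n - m) (real m + a') (real m + b)) / fact m"
    using assms
    by (simp add: beta_integral_mult_shifted_jacobi higher_pderiv_shifted_jacobi beta_integral_smult)
  also have "beta_integral (real m + a) (real m + b)
      (shifted_jacobi (n - m) (real m + a') (real m + b)) =
    pochhammer (a' - a) (n - m) / fact (n - m) * Beta (real n + b + 1) (real m + a + 1)"
    using assms beta_integral_shifted_jacobi[of "real m + a" "real m + b" "n - m" "real m + a'"]
    by (simp add: of_nat_diff add_ac)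
  finally show ?thesis by (simp add: mult_ac)
qed

section \<open>Differentiation with respect to the parameter\<close>

text \<open>A polynomial in \<open>x\<close> whose coefficients are polynomials in the parameter \<open>a\<close> is written as
  \<open>poly C [:a:]\<close>, where \<open>C\<close> is a polynomial in \<open>a\<close> with coefficients in \<open>real poly\<close>. This class is
  closed under products and under linear maps that act on \<open>x\<close>, and its derivative in \<open>a\<close> is given by
  \<open>pderiv C\<close>.\<close>

lemma poly_map_poly_linear:
  fixes \<phi> :: "real poly \<Rightarrow> real poly"
  assumes add: "\<And>p q. \<phi> (p + q) = \<phi> p + \<phi> q" and smult: "\<And>c p. \<phi> (smult c p) = smult c (\<phi> p)"
  shows "poly (map_poly \<phi> C) [:a:] = \<phi> (poly C [:a:])"
proof -
  have 0: "\<phi> 0 = 0" using smult[of 0 0] by simp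
  show ?thesis by (induction C) (simp_all add: 0 map_poly_pCons add smult)
qed

text \<open>Differentiation in the parameter commutes with every linear functional. With
  \<open>L\<close> an evaluation this identifies \<open>pderiv C\<close> as the pointwise derivative; with \<open>L\<close> an
  integral it is differentiation under the integral sign.\<close>

lemma has_field_derivative_linear_poly:
  fixes L :: "real poly \<Rightarrow> real"
  assumes add: "\<And>p q. L (p + q) = L p + L q" and smult: "\<And>c p. L (smult c p) = c * L p"
  shows "((\<lambda>a. L (poly C [:a:])) has_field_derivative L (poly (pderiv C) [:a:])) (at a)"
proof (induction C)
  case 0
  then show ?case using smult[of 0 0] by simp
next
  case (pCons c C)
  show ?case
    by (auto intro!: derivative_eq_intros pCons.IH simp: pderiv_pCons add smult)
qed

lemma rodrigues_poly_parameter: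
  "\<exists>C. \<forall>a. rodrigues_poly (s + a) B i = poly C [:a:]"
proof (induction i)
  case 0
  show ?case by (intro exI[of _ 1]) simp
next
  case (Suc i)
  then obtain C where C: "\<And>a. rodrigues_poly (s + a) B i = poly C [:a:]" by blast
  have "rodrigues_poly (s + a) B (Suc i) =
      poly ([:[:B - s, - (s + B) + 2 * real i:], [:-1, -1:]:] * C +
        [:[:1, 0, -1:]:] * map_poly pderiv C) [:a:]" for a
    by (rule poly_ext) (simp add: C poly_map_poly_linear pderiv_add pderiv_smult del: add.commute, simp add: algebra_simps)
  then show ?case by blast
qed

lemma shifted_jacobi_parameter:
  "\<exists>C. \<forall>a. shifted_jacobi n a b = poly C [:a:]"
proof -
  obtain C where C: "\<And>a. rodrigues_poly (real n + a) (real n + b) n = poly C [:a:]"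
    using rodrigues_poly_parameter by blast
  let ?\<phi> = "\<lambda>p. smult ((-1) ^ n / (2 ^ n * fact n)) (pcompose p [:-1, 2:])"
  have "shifted_jacobi n a b = poly (map_poly ?\<phi> C) [:a:]" for a
    by (simp add: shifted_jacobi_def jacobi_eq C poly_map_poly_linear pcompose_add pcompose_smult
        smult_add_right mult.commute)
  then show ?thesis by blast
qed

section \<open>Separation of variables on the parabolic biangle\<close>

text \<open>For fixed \<open>x\<close> in \<open>(0,1]\<close>, the substitution \<open>y = - sqrt x + 2 * sqrt x * s\<close> gives
  \<open>x - y\<^sup>2 = 4 x s (1 - s)\<close>. The powers of 2 from the weight and from \<open>dy\<close> form the constant; the powers
  of \<open>x\<close> from the weight, from \<open>dy\<close> and from the two factors \<open>sqrt x ^ j\<close> and \<open>sqrt x ^ k\<close> add up to the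
  exponent of \<open>x\<close>.\<close>

lemma biangle_inner_separated:
  fixes f g :: "real \<Rightarrow> real \<Rightarrow> real" and p q P Q :: "real poly"
  assumes "\<alpha> > -1" "\<beta> > -1"
    and f: "\<And>x y. x > 0 \<Longrightarrow> f x y = poly p x * sqrt x ^ j * poly P (y / sqrt x)"
    and g: "\<And>x y. x > 0 \<Longrightarrow> g x y = poly q x * sqrt x ^ k * poly Q (y / sqrt x)"
  shows "biangle_inner \<alpha> \<beta> f g =
    2 powr (2 * \<beta> + 1) * beta_integral \<alpha> (\<beta> + (real j + real k + 1) / 2) (p * q) *
    beta_integral \<beta> \<beta> (pcompose (P * Q) [:-1, 2:])"
proof -
  define F where "F = (\<lambda>z::real \<times> real. indicator biangle z * (poly (p * q) (fst z) * sqrt (fst z) ^ (j + k) *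
    poly (P * Q) (snd z / sqrt (fst z)) * (1 - fst z) powr \<alpha> * (fst z - (snd z)\<^sup>2) powr \<beta>))"
  define G where "G = (\<lambda>s::real. indicator {0..1} s *
    (poly (pcompose (P * Q) [:-1, 2:]) s * (1 - s) powr \<beta> * s powr \<beta>))"
  define H where "H = (\<lambda>x::real. indicator {0..1} x *
    (poly (p * q) x * (1 - x) powr \<alpha> * x powr (\<beta> + (real j + real k + 1) / 2)))"
  \<comment> \<open>At the origin, the only point of the biangle with \<open>x \<le> 0\<close>, the weight is \<open>0 powr \<beta> = 0\<close>,
    whereas the product forms of \<open>f\<close> and \<open>g\<close> are available for \<open>x > 0\<close>.\<close>
  have F0: "F (x, y) = 0" if "x \<notin> {0<..1}" for x y
  proof (cases "x = 0")
    case True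
    then show ?thesis by (cases "y = 0") (auto simp: F_def biangle_def)
  next
    case False
    then have "x < 0 \<or> x > 1" using that by auto
    then have "(x, y) \<notin> biangle"
      using zero_le_power2[of y] unfolding biangle_def mem_Collect_eq case_prod_conv by linarith
    then show ?thesis by (simp add: F_def)
  qed
  have inner: "biangle_inner \<alpha> \<beta> f g = integral\<^sup>L lborel F"
    unfolding biangle_inner_def set_lebesgue_integral_def
  proof (intro Bochner_Integration.integral_cong refl)
    fix z :: "real \<times> real"
    obtain x y where z: "z = (x, y)" by force
    show "indicat_real biangle z *\<^sub>R (case z of (x, y) \<Rightarrow>
        f x y * g x y * (1 - x) powr \<alpha> * (x - y\<^sup>2) powr \<beta>) = F z"
    proof (cases "x > 0")
      case True
      then show ?thesis by (simp add: z F_def f g power_add)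
    next
      case False
      then have "z \<notin> biangle \<or> x - y\<^sup>2 = 0"
        using zero_le_power2[of y] unfolding z biangle_def mem_Collect_eq case_prod_conv by linarith
      then show ?thesis using F0[of x y] False by (auto simp: z)
    qed
  qed
  have slice: "2 * sqrt x * F (x, - sqrt x + (2 * sqrt x) * s) = 2 powr (2 * \<beta> + 1) * H x * G s"
    if x: "x \<in> {0<..1}" for x s
  proof -
    let ?y = "- sqrt x + (2 * sqrt x) * s"
    have y: "?y = sqrt x * (2 * s - 1)" by (simp add: algebra_simps)
    have xy: "x - ?y\<^sup>2 = 4 * x * (s * (1 - s))"
      unfolding y using x by (simp add: power_mult_distrib power2_eq_square algebra_simps)
    have "(x, ?y) \<in> biangle \<longleftrightarrow> 0 \<le> 4 * x * (s * (1 - s))"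
      using x by (auto simp: biangle_def simp flip: xy)
    also have "\<dots> \<longleftrightarrow> s \<in> {0..1}"
      using x by (auto simp: zero_le_mult_iff)
    finally have ind: "indicat_real biangle (x, ?y) = indicator {0..1} s"
      by (simp add: indicator_def)
    show ?thesis
    proof (cases "s \<in> {0..1}")
      case True
      have ys: "?y / sqrt x = 2 * s - 1" unfolding y using x by simp
      have w: "(x - ?y\<^sup>2) powr \<beta> = 2 powr (2 * \<beta>) * x powr \<beta> * (s powr \<beta> * (1 - s) powr \<beta>)"
        unfolding xy using x True by (simp add: powr_mult powr_powr[symmetric])
      have "sqrt x * sqrt x ^ (j + k) = x powr ((real j + real k + 1) / 2)"
        using x by (simp add: powr_half_sqrt[symmetric] powr_powr powr_realpow[symmetric] powr_add
            add_divide_distrib power_add[symmetric] power_mult_distrib[symmetric])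
      then have "sqrt x * sqrt x ^ (j + k) * x powr \<beta> = x powr (\<beta> + (real j + real k + 1) / 2)"
        by (simp add: powr_add)
      then show ?thesis
        using x True unfolding F_def H_def G_def fst_conv snd_conv ind w ys
        by (simp add: poly_pcompose powr_add algebra_simps)
    next
      case False
      then show ?thesis unfolding F_def G_def fst_conv snd_conv ind by simp
    qed
  qed
  have intG: "integrable lborel G"
    using beta_integrable[OF \<open>\<beta> > -1\<close> \<open>\<beta> > -1\<close>] by (simp add: G_def set_integrable_def)
  have "\<beta> + (real j + real k + 1) / 2 > -1"
    using \<open>\<beta> > -1\<close> by (simp add: add_pos_nonneg field_simps)
  from beta_integrable[OF \<open>\<alpha> > -1\<close> this, of "p * q"]
  have intH: "integrable lborel H" by (simp add: H_def set_integrable_def)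
  have H0: "H x = 0" if "x \<notin> {0<..1}" for x
    using that by (auto simp: H_def indicator_def)
  \<comment> \<open>Needed twice: with the identity for the value of the integral and with the absolute value
    for the integrability in Fubini's theorem. The multiplicative \<open>\<psi>\<close> covers both.\<close>
  have bochner: "has_bochner_integral lborel (\<lambda>y. \<psi> (F (x, y)))
      (2 powr (2 * \<beta> + 1) * \<psi> (H x) * integral\<^sup>L lborel (\<lambda>s. \<psi> (G s)))"
    if \<psi>: "\<And>s t. \<psi> (s * t) = \<psi> s * \<psi> t" "\<And>t. t \<ge> 0 \<Longrightarrow> \<psi> t = t" and I: "integrable lborel (\<lambda>s. \<psi> (G s))"
    for \<psi> :: "real \<Rightarrow> real" and x
  proof (cases "x \<in> {0<..1}")
    case True
    have "\<psi> (F (x, - sqrt x + (2 * sqrt x) * s)) =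
       2 powr (2 * \<beta> + 1) * \<psi> (H x) / (2 * sqrt x) * \<psi> (G s)" for s
    proof -
      have "\<psi> (2 * sqrt x * F (x, - sqrt x + (2 * sqrt x) * s)) = \<psi> (2 powr (2 * \<beta> + 1) * H x * G s)"
        by (simp only: slice[OF True])
      then show ?thesis using True by (simp add: \<psi> field_simps del: mult_minus_left mult_minus_right)
    qed
    then have "has_bochner_integral lborel (\<lambda>s. \<psi> (F (x, - sqrt x + (2 * sqrt x) * s)))
        (2 powr (2 * \<beta> + 1) * \<psi> (H x) / (2 * sqrt x) * integral\<^sup>L lborel (\<lambda>s. \<psi> (G s)))"
      using has_bochner_integral_integrable[OF I] by (simp only: has_bochner_integral_mult_right)
    then show ?thesis
      using True by (subst lborel_has_bochner_integral_real_affine_iff[of "2 * sqrt x" _ _ "- sqrt x"])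
         (simp_all add: field_simps)
  next
    case False
    then show ?thesis using \<psi>(2)[of 0] by (simp add: F0 H0 has_bochner_integral_zero)
  qed
  note slice_integral = bochner[of "\<lambda>t. t", OF _ _ intG]
  note slice_norm = bochner[of abs, OF abs_mult _ integrable_abs[OF intG]]
  have "F \<in> borel_measurable (lborel \<Otimes>\<^sub>M lborel)"
  proof -
    have "closed biangle"
      unfolding biangle_def case_prod_unfold
      by (intro closed_Collect_conj closed_Collect_le continuous_intros)
    then have [measurable]: "biangle \<in> sets borel" by (rule borel_closed)
    have [measurable (raw)]: "(\<lambda>z. poly r (h z)) \<in> borel_measurable borel"
      if "h \<in> borel_measurable borel" for r and h :: "real \<times> real \<Rightarrow> real"
      using that by (rule borel_measurable_continuous_on[rotated]) (intro continuous_intros)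
    have [measurable]: "fst \<in> borel_measurable (borel :: (real \<times> real) measure)"
        "snd \<in> borel_measurable (borel :: (real \<times> real) measure)"
      by (intro borel_measurable_continuous_onI continuous_intros)+
    have "F \<in> borel_measurable borel" unfolding F_def by measurable
    then show ?thesis by (simp add: lborel_prod)
  qed
  then have intF: "integrable (lborel \<Otimes>\<^sub>M lborel) F"
  proof (rule lborel_pair.Fubini_integrable)
    show "integrable lborel (\<lambda>x. \<integral>y. norm (F (x, y)) \<partial>lborel)"
      using integrable_abs[OF intH]
      by (simp add: has_bochner_integral_integral_eq[OF slice_norm])
    show "AE x in lborel. integrable lborel (\<lambda>y. F (x, y))"
      using slice_integral by (auto simp: has_bochner_integral_iff)
  qed
  have "integral\<^sup>L lborel F = (\<integral>x. \<integral>y. F (x, y) \<partial>lborel \<partial>lborel)"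
    using lborel_pair.integral_fst'[OF intF] by (simp add: lborel_prod)
  also have "\<dots> = 2 powr (2 * \<beta> + 1) * integral\<^sup>L lborel H * integral\<^sup>L lborel G"
    by (simp add: has_bochner_integral_integral_eq[OF slice_integral])
  finally show ?thesis
    by (simp add: inner beta_integral_def set_lebesgue_integral_def G_def H_def)
qed

section \<open>Norms and connection coefficients\<close>

lemma has_field_derivative_pochhammer:
  fixes z :: real
  assumes "\<And>s. s < N \<Longrightarrow> z + real s \<noteq> 0"
  shows "((\<lambda>z. pochhammer z N) has_field_derivative
    pochhammer z N * (\<Sum>s<N. 1 / (z + real s))) (at z)"
  using assms
proof (induction N)
  case (Suc N)
  then have "((\<lambda>z. pochhammer z N * (z + real N)) has_field_derivative
      pochhammer z N * (\<Sum>s<N. 1 / (z + real s)) * (z + real N) + 1 * pochhammer z N) (at z)"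
    by (intro DERIV_mult Suc.IH) (auto intro!: derivative_eq_intros)
  moreover have "P * S * w + 1 * P = P * w * (S + 1 / w)" if "w \<noteq> 0" for P S w :: real
    using that by (simp add: field_simps)
  from this[OF Suc.prems[OF lessI]]
  have "pochhammer z N * (\<Sum>s<N. 1 / (z + real s)) * (z + real N) + 1 * pochhammer z N =
      pochhammer z (Suc N) * (\<Sum>s<Suc N. 1 / (z + real s))"
    by (simp only: pochhammer_Suc sum.lessThan_Suc)
  ultimately show ?case by (simp only: pochhammer_Suc)
qed simp

text \<open>At 0 the first factor vanishes, so only the product of the other factors survives.\<close>

lemma has_field_derivative_pochhammer_0:
  assumes "N > 0"
  shows "((\<lambda>z::real. pochhammer z N) has_field_derivative fact (N - 1)) (at 0)"
proof -
  obtain M where M: "N = Suc M" using assms gr0_implies_Suc by blast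
  have "((\<lambda>z. pochhammer z M) has_field_derivative
      pochhammer (0 + 1) M * (\<Sum>s<M. 1 / (0 + 1 + real s))) (at (0 + 1 :: real))"
    by (rule DERIV_cong[OF has_field_derivative_pochhammer]) (auto simp: add_eq_0_iff)
  then have "((\<lambda>z::real. z * pochhammer (z + 1) M) has_field_derivative
      1 * pochhammer (0 + 1) M + pochhammer (0 + 1) M * (\<Sum>s<M. 1 / (0 + 1 + real s)) * 0) (at 0)"
    by (intro DERIV_mult DERIV_ident) (subst (asm) DERIV_shift)
  then show ?thesis by (simp add: M pochhammer_rec pochhammer_fact)
qed

definition jacobi_norm2 :: "nat \<Rightarrow> real \<Rightarrow> real \<Rightarrow> real" where
  "jacobi_norm2 n a b = beta_integral a b (shifted_jacobi n a b * shifted_jacobi n a b)"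

lemma jacobi_norm2_eq:
  assumes "a > -1" "b > -1"
  shows "jacobi_norm2 n a b =
    pochhammer (real n + a + b + 1) n * Beta (real n + b + 1) (real n + a + 1) / fact n"
  using beta_integral_shifted_jacobi_mult_le[OF assms, of n n a] by (simp add: jacobi_norm2_def)

lemma Gamma_add_nat:
  assumes "z > (0::real)"
  shows "Gamma (z + real k) = pochhammer z k * Gamma z"
proof -
  have "z \<notin> \<int>\<^sub>\<le>\<^sub>0" using assms by (auto elim!: nonpos_Ints_cases)
  then show ?thesis using Gamma_real_pos[OF assms] by (simp add: pochhammer_Gamma)
qed

lemma jacobi_norm2_0:
  assumes "a > -1" "b > -1"
  shows "jacobi_norm2 0 a b = Gamma (a + 1) * Gamma (b + 1) / Gamma (a + b + 2)"
  using assms by (simp add: jacobi_norm2_eq Beta_def add_ac)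

text \<open>As \<open>a + b + 1 > -1\<close>, positivity of \<open>a + b + n + 1\<close> can fail for \<open>n = 0\<close> only. There the
  argument of the Gamma function may hit its pole at 0, and \<open>jacobi_norm2_0\<close> has the form in
  which \<open>z \<Gamma>(z)\<close> is replaced by \<open>\<Gamma>(z + 1)\<close>.\<close>

lemma jacobi_norm2_Gamma:
  assumes "a > -1" "b > -1" "a + b + real n + 1 > 0"
  shows "jacobi_norm2 n a b = Gamma (a + real n + 1) * Gamma (b + real n + 1) /
    (fact n * Gamma (a + b + real n + 1) * (a + b + 2 * real n + 1))"
proof -
  have "Gamma (a + b + real n + 1 + real (Suc n)) =
      pochhammer (a + b + real n + 1) (Suc n) * Gamma (a + b + real n + 1)"
    using assms by (intro Gamma_add_nat)
  moreover have "pochhammer (a + b + real n + 1) n > 0" "Gamma (a + b + real n + 1) > 0"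
    using assms by (simp_all add: pochhammer_pos Gamma_real_pos)
  ultimately show ?thesis
    using assms by (simp add: jacobi_norm2_eq Beta_def pochhammer_Suc add_ac mult_ac)
qed

lemma koornwinder_h_eq_jacobi_norm2:
  assumes "\<alpha> > -1" "\<beta> > -1" "k \<le> n"
  shows "koornwinder_h n k \<alpha> \<beta> =
    2 powr (2 * \<beta> + 1) * jacobi_norm2 (n - k) \<alpha> (\<beta> + real k + 1/2) * jacobi_norm2 k \<beta> \<beta>"
proof -
  have x: "jacobi_norm2 (n - k) \<alpha> (\<beta> + real k + 1/2) =
    Gamma (\<alpha> + real n - real k + 1) * Gamma (\<beta> + real n + 3/2) / (fact (n - k) *
      (if n = 0 then Gamma (\<alpha> + \<beta> + 5/2)
       else Gamma (\<alpha> + \<beta> + real n + 3/2) * (\<alpha> + \<beta> + 2 * real n - real k + 3/2)))"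
  proof (cases "n = 0")
    case True
    then show ?thesis using assms by (simp add: jacobi_norm2_0 add_ac)
  next
    case False
    then have "\<alpha> + (\<beta> + real k + 1/2) + real (n - k) + 1 > 0" using assms by (simp add: of_nat_diff)
    then show ?thesis
      using False assms by (subst jacobi_norm2_Gamma) (auto simp: of_nat_diff algebra_simps)
  qed
  have y: "jacobi_norm2 k \<beta> \<beta> = (Gamma (\<beta> + real k + 1))\<^sup>2 / (fact k *
      (if k = 0 then Gamma (2 * \<beta> + 2)
       else (2 * \<beta> + 2 * real k + 1) * Gamma (2 * \<beta> + real k + 1)))"
  proof (cases "k = 0")
    case True
    then show ?thesis using assms by (simp add: jacobi_norm2_0 power2_eq_square)
  next
    case False
    then have "\<beta> + \<beta> + real k + 1 > 0" using assms by simp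
    then show ?thesis
      using False assms by (subst jacobi_norm2_Gamma) (auto simp: power2_eq_square mult_ac)
  qed
  show ?thesis unfolding koornwinder_h_def x y by (simp add: mult_ac)
qed

text \<open>The coefficient of \<open>S\<^sub>m\<close> in the expansion of the derivative of \<open>S\<^sub>n\<close> in its first parameter, for
  \<open>m < n\<close>. For \<open>m = 0\<close> the factor \<open>a + b + 1\<close>, which may vanish, is cancelled.\<close>

definition jacobi_connection :: "nat \<Rightarrow> nat \<Rightarrow> real \<Rightarrow> real \<Rightarrow> real" where
  "jacobi_connection n m a b =
    (if m = 0 then 1 / pochhammer (a + b + 2) (n - 1)
     else (a + b + 2 * real m + 1) / pochhammer (a + b + real m + 1) (n - m)) *
    pochhammer (b + real m + 1) (n - m) / (real (n - m) * (a + b + real n + real m + 1))"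

text \<open>With \<open>s = a + b + 1\<close> and \<open>m > 0\<close>, the Gamma factors reduce the claim to two factorizations of
  \<open>(s + m)\<^sub>n\<^sub>+\<^sub>1\<close>: one cuts the product after \<open>n - m\<close> factors, the other one before and after the
  factor \<open>s + 2 m\<close>.\<close>

lemma jacobi_connection_mult_norm2:
  assumes "a > -1" "b > -1" "m < n"
  shows "jacobi_connection n m a b * jacobi_norm2 m a b =
    pochhammer (real n + a + b + 1) m * Beta (real n + b + 1) (real m + a + 1) /
    (fact m * real (n - m))"
proof -
  define s where "s = a + b + 1"
  define N where "N = n - m"
  have n: "n = m + N" and N: "N > 0" using assms by (auto simp: N_def)
  have s: "s > -1" using assms by (simp add: s_def)
  have pos: "s + 2 * real m + 1 > 0" "s + real n + real m > 0" "b + real m + 1 > 0"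
    using s assms by (auto simp: n)
  define c where "c = (if m = 0 then 1 / pochhammer (s + 1) (n - 1)
     else (s + 2 * real m) / pochhammer (s + real m) N)"
  have key: "c * pochhammer (s + real m) m * pochhammer (s + 2 * real m + 1) N =
      pochhammer (s + real n) m * (s + real n + real m)"
  proof (cases "m = 0")
    case True
    obtain M where M: "N = Suc M" using N gr0_implies_Suc by blast
    have "pochhammer (s + 1) M > 0" using s by (intro pochhammer_pos) simp
    then show ?thesis using True by (simp add: c_def n M pochhammer_Suc add_ac)
  next
    case False
    then have sm: "pochhammer (s + real m) N > 0" using s by (intro pochhammer_pos) simp
    have "pochhammer (s + real m) N * (pochhammer (s + real n) m * (s + real n + real m)) =
        pochhammer (s + real m) (N + Suc m)"
      by (simp add: pochhammer_product' pochhammer_Suc n add_ac)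
    also have "\<dots> = pochhammer (s + real m) (Suc m + N)" by (simp add: add_ac)
    also have "\<dots> = (s + 2 * real m) * pochhammer (s + real m) m * pochhammer (s + 2 * real m + 1) N"
      unfolding pochhammer_product' by (simp add: pochhammer_Suc add_ac mult_ac)
    finally show ?thesis using False sm by (simp add: c_def field_simps)
  qed
  have b: "Gamma (real n + b + 1) = pochhammer (b + real m + 1) N * Gamma (b + real m + 1)"
    using Gamma_add_nat[OF pos(3), of N] by (simp add: n add_ac)
  have ab: "Gamma (s + real n + real m + 1) =
      pochhammer (s + 2 * real m + 1) N * Gamma (s + 2 * real m + 1)"
    using Gamma_add_nat[OF pos(1), of N] by (simp add: n add_ac)
  have G: "pochhammer (s + 2 * real m + 1) N > 0" "Gamma (s + 2 * real m + 1) > 0"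
    using pos by (simp_all add: pochhammer_pos Gamma_real_pos)
  have 1: "Beta (real n + b + 1) (real m + a + 1) =
      Gamma (real n + b + 1) * Gamma (real m + a + 1) / Gamma (s + real n + real m + 1)"
    by (simp add: Beta_def s_def add_ac)
  have 2: "Beta (real m + b + 1) (real m + a + 1) =
      Gamma (b + real m + 1) * Gamma (real m + a + 1) / Gamma (s + 2 * real m + 1)"
    by (simp add: Beta_def s_def add_ac)
  have 3: "jacobi_connection n m a b =
      c * pochhammer (b + real m + 1) N / (real N * (s + real n + real m))"
    by (simp add: jacobi_connection_def c_def s_def N_def add_ac)
  have 4: "real m + a + b + 1 = s + real m" "real n + a + b + 1 = s + real n"
    by (simp_all add: s_def)
  have "c * pochhammer (s + real m) m =
      pochhammer (s + real n) m * (s + real n + real m) / pochhammer (s + 2 * real m + 1) N"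
    using key G by (simp add: field_simps)
  moreover have "jacobi_connection n m a b * jacobi_norm2 m a b =
      (c * pochhammer (s + real m) m) * (pochhammer (b + real m + 1) N * Gamma (b + real m + 1) *
        Gamma (real m + a + 1) /
        (Gamma (s + 2 * real m + 1) * fact m * real N * (s + real n + real m)))"
    unfolding jacobi_norm2_eq[OF assms(1,2)] 2 3 4 by (simp add: mult_ac)
  ultimately have "jacobi_connection n m a b * jacobi_norm2 m a b =
      (pochhammer (s + real n) m * (s + real n + real m) / pochhammer (s + 2 * real m + 1) N) *
      (pochhammer (b + real m + 1) N * Gamma (b + real m + 1) * Gamma (real m + a + 1) /
        (Gamma (s + 2 * real m + 1) * fact m * real N * (s + real n + real m)))"
    by simp
  also have "\<dots> = pochhammer (real n + a + b + 1) m * Beta (real n + b + 1) (real m + a + 1) /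
      (fact m * real (n - m))"
    unfolding 1 4 b ab N_def[symmetric] using pos G by simp
  finally show ?thesis .
qed

text \<open>Both sides are the derivative at \<open>a' = a\<close> of the integral of \<open>S\<^sub>m S\<^sub>n\<close> where only \<open>S\<^sub>n\<close> depends on \<open>a'\<close>: the
  left-hand side by differentiation under the integral, the right-hand side by differentiation of
  the closed form.\<close>

lemma beta_integral_shifted_jacobi_mult_deriv:
  assumes "a > -1" "b > -1" and C: "\<And>a'. shifted_jacobi n a' b = poly C [:a':]"
  shows "beta_integral a b (shifted_jacobi m a b * poly (pderiv C) [:a:]) =
    (if m > n then 0
     else if m < n then jacobi_connection n m a b * jacobi_norm2 m a b
     else (\<Sum>s<n. 1 / (real n + a + b + 1 + real s)) * jacobi_norm2 n a b)"
    (is "?I = ?R")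
proof -
  let ?L = "\<lambda>q. beta_integral a b (shifted_jacobi m a b * q)"
  let ?p = "\<lambda>a'. pochhammer (real n + a' + b + 1) m"
  have "((\<lambda>a'. ?L (shifted_jacobi n a' b)) has_field_derivative ?I) (at a)"
    unfolding C
    by (rule has_field_derivative_linear_poly)
      (simp_all add: distrib_left beta_integral_add[OF assms(1,2)] beta_integral_smult)
  moreover have "((\<lambda>a'. ?L (shifted_jacobi n a' b)) has_field_derivative ?R) (at a)"
  proof (cases "m > n")
    case True
    then show ?thesis using assms(1,2) by (simp add: beta_integral_shifted_jacobi_mult_gt)
  next
    case False
    let ?c = "Beta (real n + b + 1) (real m + a + 1) / (fact m * fact (n - m))"
    have L: "?L (shifted_jacobi n a' b) = ?p a' * pochhammer (a' - a) (n - m) * ?c" for a'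
      using False assms(1,2) by (simp add: beta_integral_shifted_jacobi_mult_le)
    have "real n + a + b + 1 + real s \<noteq> 0" if "s < m" for s
      using that False assms(1,2) by linarith
    then have "((\<lambda>z. pochhammer z m) has_field_derivative
        ?p a * (\<Sum>s<m. 1 / (real n + a + b + 1 + real s))) (at (a + (real n + b + 1)))"
      using has_field_derivative_pochhammer[of m "real n + a + b + 1"] by (simp add: add_ac)
    then have p: "(?p has_field_derivative ?p a * (\<Sum>s<m. 1 / (real n + a + b + 1 + real s))) (at a)"
      by (subst (asm) DERIV_shift) (simp add: add_ac)
    show ?thesis
    proof (cases "m = n")
      case True
      then show ?thesis
        unfolding L using DERIV_cmult_right[OF p, of ?c]
        by (simp add: jacobi_norm2_eq[OF assms(1,2)] mult_ac)
    next
      case m: False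
      then have "((\<lambda>z::real. pochhammer z (n - m)) has_field_derivative fact (n - m - 1))
          (at (a + - a))"
        using False has_field_derivative_pochhammer_0[of "n - m"] by simp
      then have "((\<lambda>a'. pochhammer (a' - a) (n - m)) has_field_derivative fact (n - m - 1)) (at a)"
        by (subst (asm) DERIV_shift) simp
      from DERIV_cmult_right[OF DERIV_mult[OF p this], of ?c]
      have "((\<lambda>a'. ?L (shifted_jacobi n a' b)) has_field_derivative
          ?p a * fact (n - m - 1) * ?c) (at a)"
        unfolding L using m False by (simp add: pochhammer_0_left mult_ac)
      moreover have "fact (n - m) = real (n - m) * fact (n - m - 1)"
        using m False by (intro fact_reduce) simp
      ultimately show ?thesis
        using m False by (simp add: jacobi_connection_mult_norm2[OF assms(1,2)])
    qed
  qed
  ultimately show ?thesis by (rule DERIV_unique)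
qed

section \<open>The derivative of the Koornwinder polynomials\<close>

lemma biangle_inner_koornwinder_deriv:
  assumes "\<alpha> > -1" "\<beta> > -1"
    and C: "\<And>a. shifted_jacobi (n - k) a (\<beta> + real k + 1/2) = poly C [:a:]"
  shows "biangle_inner \<alpha> \<beta> (\<lambda>x y. poly2 (koornwinder m j \<alpha> \<beta>) x y)
      (\<lambda>x y. deriv (\<lambda>a. poly2 (koornwinder n k a \<beta>) x y) \<alpha>) =
    2 powr (2 * \<beta> + 1) *
    beta_integral \<alpha> (\<beta> + (real j + real k + 1) / 2)
      (shifted_jacobi (m - j) \<alpha> (\<beta> + real j + 1/2) * poly (pderiv C) [:\<alpha>:]) *
    beta_integral \<beta> \<beta> (shifted_jacobi j \<beta> \<beta> * shifted_jacobi k \<beta> \<beta>)"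
  unfolding shifted_jacobi_def[of j] shifted_jacobi_def[of k] pcompose_mult[symmetric]
proof (rule biangle_inner_separated[OF assms(1,2)])
  fix x y :: real
  assume x: "x > 0"
  show "poly2 (koornwinder m j \<alpha> \<beta>) x y =
      poly (shifted_jacobi (m - j) \<alpha> (\<beta> + real j + 1/2)) x * sqrt x ^ j *
      poly (jacobi j \<beta> \<beta>) (y / sqrt x)"
    by (simp add: poly2_koornwinder[OF x] shifted_jacobi_def poly_pcompose mult.commute)
  have "poly2 (koornwinder n k a \<beta>) x y =
      poly (poly C [:a:]) x * sqrt x ^ k * poly (jacobi k \<beta> \<beta>) (y / sqrt x)" for a
    by (simp add: poly2_koornwinder[OF x] shifted_jacobi_def poly_pcompose mult.commute flip: C)
  moreover have "((\<lambda>a. poly (poly C [:a:]) x) has_field_derivative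
      poly (poly (pderiv C) [:\<alpha>:]) x) (at \<alpha>)"
    by (rule has_field_derivative_linear_poly) simp_all
  ultimately show "deriv (\<lambda>a. poly2 (koornwinder n k a \<beta>) x y) \<alpha> =
      poly (poly (pderiv C) [:\<alpha>:]) x * sqrt x ^ k * poly (jacobi k \<beta> \<beta>) (y / sqrt x)"
    by (intro DERIV_imp_deriv) (auto intro!: DERIV_cmult_right)
qed

text \<open>The case distinctions do not match: \<open>koornwinder_A\<close> cancels the critical factor for \<open>m = 0\<close>, and
  \<open>jacobi_connection\<close> does so for \<open>m = k\<close>. For \<open>m = k > 0\<close> the factor is positive, so both forms agree.\<close>

lemma koornwinder_A_eq_jacobi_connection:
  assumes "\<alpha> > -1" "\<beta> > -1" "k \<le> m" "m < n"
  shows "koornwinder_A n k m \<alpha> \<beta> =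
    jacobi_connection (n - k) (m - k) \<alpha> (\<beta> + real k + 1/2) * koornwinder_h m k \<alpha> \<beta>"
proof (cases "m = 0")
  case True
  then show ?thesis using assms by (simp add: koornwinder_A_def jacobi_connection_def add_ac)
next
  case False
  let ?b = "\<beta> + real k + 1/2"
  have s: "\<alpha> + ?b + 1 > 0" if "m = k" using False assms that by simp
  have "(if m - k = 0 then 1 / pochhammer (\<alpha> + ?b + 2) (n - k - 1)
     else (\<alpha> + ?b + 2 * real (m - k) + 1) / pochhammer (\<alpha> + ?b + real (m - k) + 1) (n - k - (m - k))) =
     (\<alpha> + \<beta> - real k + 2 * real m + 3/2) / pochhammer (\<alpha> + \<beta> + real m + 3/2) (n - m)"
  proof (cases "m = k")
    case True
    obtain N where N: "n - k = Suc N" using assms True by (metis Suc_diff_Suc)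
    have "pochhammer (\<alpha> + ?b + 1) (Suc N) = (\<alpha> + ?b + 1) * pochhammer (\<alpha> + ?b + 2) N"
      by (simp add: pochhammer_rec add_ac)
    then show ?thesis using True s N by (simp add: add_ac)
  next
    case False
    then show ?thesis using assms by (simp add: of_nat_diff add_ac)
  qed
  then show ?thesis
    using False assms
    unfolding jacobi_connection_def koornwinder_A_def by (simp add: of_nat_diff algebra_simps)
qed

theorem theorem5:
  fixes \<alpha> \<beta> :: real and n m j k :: nat
  assumes "\<alpha> > -1" and "\<beta> > -1" and "j \<le> m"
  shows "(n \<ge> k + 1 \<longrightarrow>
      biangle_inner \<alpha> \<beta> (\<lambda>x y. poly2 (koornwinder m j \<alpha> \<beta>) x y)
        (\<lambda>x y. deriv (\<lambda>a. poly2 (koornwinder n k a \<beta>) x y) \<alpha>) =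
      (if k \<noteq> j then 0
       else if m > n then 0
       else if n > m then koornwinder_A n k m \<alpha> \<beta>
       else koornwinder_B n k \<alpha> \<beta>)) \<and>
    (n = k \<longrightarrow>
      biangle_inner \<alpha> \<beta> (\<lambda>x y. poly2 (koornwinder m j \<alpha> \<beta>) x y)
        (\<lambda>x y. deriv (\<lambda>a. poly2 (koornwinder n n a \<beta>) x y) \<alpha>) = 0)"
proof -
  obtain C where C: "\<And>a. shifted_jacobi (n - k) a (\<beta> + real k + 1/2) = poly C [:a:]"
    using shifted_jacobi_parameter by blast
  let ?inner = "biangle_inner \<alpha> \<beta> (\<lambda>x y. poly2 (koornwinder m j \<alpha> \<beta>) x y)
    (\<lambda>x y. deriv (\<lambda>a. poly2 (koornwinder n k a \<beta>) x y) \<alpha>)"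
  let ?b = "\<beta> + real k + 1/2"
  note inner = biangle_inner_koornwinder_deriv[OF assms(1,2) C, of m j]
  have off_diagonal: "?inner = 0" if "k \<noteq> j"
  proof -
    have "beta_integral \<beta> \<beta> (shifted_jacobi j \<beta> \<beta> * shifted_jacobi k \<beta> \<beta>) = 0"
    proof (cases "k < j")
      case True
      then show ?thesis using assms by (intro beta_integral_shifted_jacobi_mult_gt)
    next
      case False
      then have "j < k" using that by simp
      then show ?thesis
        using assms by (subst mult.commute) (intro beta_integral_shifted_jacobi_mult_gt)
    qed
    then show ?thesis by (simp add: inner)
  qed
  have diagonal: "?inner = 2 powr (2 * \<beta> + 1) *
      (if m - k > n - k then 0
       else if m - k < n - k
       then jacobi_connection (n - k) (m - k) \<alpha> ?b * jacobi_norm2 (m - k) \<alpha> ?b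
       else (\<Sum>s<n - k. 1 / (real (n - k) + \<alpha> + ?b + 1 + real s)) * jacobi_norm2 (n - k) \<alpha> ?b) *
      jacobi_norm2 k \<beta> \<beta>" if "k = j"
  proof -
    have b: "\<beta> + (real k + real k + 1) / 2 = ?b" by (simp add: field_simps)
    have "?b > -1" using assms by simp
    note inner' = beta_integral_shifted_jacobi_mult_deriv[OF assms(1) this C, of "m - k"]
    show ?thesis
      unfolding inner unfolding that[symmetric] b inner' jacobi_norm2_def[of k] by (rule refl)
  qed
  show ?thesis
  proof (intro conjI impI)
    assume n: "n \<ge> k + 1"
    show "?inner = (if k \<noteq> j then 0 else if m > n then 0
       else if n > m then koornwinder_A n k m \<alpha> \<beta> else koornwinder_B n k \<alpha> \<beta>)"
    proof (cases "k = j")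
      case True
      have "(\<Sum>s<n - k. 1 / (real (n - k) + \<alpha> + ?b + 1 + real s)) =
          (\<Sum>s<n - k. 1 / (\<alpha> + \<beta> + real n + real s + 3/2))"
        using n by (intro sum.cong refl arg_cong2[where f = "(/)"]) (simp add: of_nat_diff)
      then show ?thesis
        using True n assms unfolding diagonal[OF True]
        by (auto simp: koornwinder_A_eq_jacobi_connection koornwinder_B_def
            koornwinder_h_eq_jacobi_norm2)
    qed (simp add: off_diagonal)
  next
    assume n: "n = k"
    have "?inner = 0"
      using off_diagonal diagonal n by (cases "k = j") auto
    then show "biangle_inner \<alpha> \<beta> (\<lambda>x y. poly2 (koornwinder m j \<alpha> \<beta>) x y)
        (\<lambda>x y. deriv (\<lambda>a. poly2 (koornwinder n n a \<beta>) x y) \<alpha>) = 0"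
      by (simp add: n)
  qed
qed

end
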